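(* Let $\rho$ be a two-qubit density matrix, and let $A,B$ be complex $2\times 2$ matrices with $A^\dagger A\le I_2$, $B^\dagger B\le I_2$, $\det(A)\neq 0$, $\det(B)\ne 0$. Let $$\rho'=\frac{(A\otimes B)\rho(A\otimes B)^\dagger}{\operatorname{Tr}\left((A\otimes B)\rho(A\otimes B)^\dagger\right)}.$$ Let $C$ and $C'$ denote the concurrence of $\rho$ and $\rho'$ respectively. Then $$C'=C\,\frac{|\det(A)|\,|\det(B)|}{\operatorname{Tr}\left((A^\dagger A\otimes B^\dagger B)\rho\right)}.$$
   Context: A two-qubit density matrix is a positive semidefinite complex $4\times4$ matrix on $\mathbb{C}^2\otimes\mathbb{C}^2$ of trace one. The concurrence of $\rho$ is $\max(0,\tau_1-\tau_2-\tau_3-\tau_4)$, where $\tau_1\ge\tau_2\ge\tau_3\ge\tau_4$ are the singular values of $X^T(\sigma_y\otimes\sigma_y)X$ for any square matrix $X$ with $\rho=XX^\dagger$ (the value does not depend on the choice of $X$). Here $\sigma_y=\begin{pmatrix}0&-i\\ i&0\end{pmatrix}$, $^T$ is the transpose and $^\dagger$ the conjugate transpose. *)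

theory Defs
  imports "Jordan_Normal_Form.Schur_Decomposition" "HOL-Library.Multiset"
begin

definition trace :: "complex mat \<Rightarrow> complex" where
  "trace M = (\<Sum>i<dim_row M. M $$ (i, i))"

(* Row index (i, k) of A \<otimes> B is encoded as i * dim_row B + k, and similarly for columns. *)
definition kron :: "complex mat \<Rightarrow> complex mat \<Rightarrow> complex mat" (infixl \<open>\<otimes>\<^sub>m\<close> 70) where
  "A \<otimes>\<^sub>m B = mat (dim_row A * dim_row B) (dim_col A * dim_col B)
     (\<lambda>(i, j). A $$ (i div dim_row B, j div dim_col B) * B $$ (i mod dim_row B, j mod dim_col B))"

(* The order on complex numbers is that of Complex_Order: 0 \<le> z says that z is real and
   nonnegative. *)
definition psd :: "complex mat \<Rightarrow> bool" where
  "psd M \<longleftrightarrow> square_mat M \<and> mat_adjoint M = M \<and>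
     (\<forall>v \<in> carrier_vec (dim_row M). 0 \<le> (M *\<^sub>v v) \<bullet>c v)"

(* The Loewner order; the library's \<open>\<le>\<close> on matrices is entrywise. *)
definition loewner_le :: "complex mat \<Rightarrow> complex mat \<Rightarrow> bool" (infix \<open>\<le>\<^sub>L\<close> 50) where
  "M \<le>\<^sub>L N \<longleftrightarrow> dim_row M = dim_row N \<and> dim_col M = dim_col N \<and> psd (N - M)"

definition two_qubit_density :: "complex mat \<Rightarrow> bool" where
  "two_qubit_density \<rho> \<longleftrightarrow> \<rho> \<in> carrier_mat 4 4 \<and> psd \<rho> \<and> trace \<rho> = 1"

(* In decreasing order and with multiplicity: the square roots of the eigenvalues of the
   positive semidefinite matrix M\<dagger>M, which are the roots of its characteristic polynomial. *)
definition singular_values :: "complex mat \<Rightarrow> real list" where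
  "singular_values M = rev (sorted_list_of_multiset
     (image_mset (\<lambda>z. sqrt (Re z)) (proots (char_poly (mat_adjoint M * M)))))"

definition sigma_y :: "complex mat" where
  "sigma_y = mat_of_rows_list 2 [[0, - \<i>], [\<i>, 0]]"

definition concurrence_via :: "complex mat \<Rightarrow> real" where
  "concurrence_via X =
     (let \<tau> = singular_values (transpose_mat X * (sigma_y \<otimes>\<^sub>m sigma_y) * X)
      in max 0 (\<tau> ! 0 - \<tau> ! 1 - \<tau> ! 2 - \<tau> ! 3))"

(* The value does not depend on the choice of X, hence the definite description. *)
definition concurrence :: "complex mat \<Rightarrow> real" where
  "concurrence \<rho> =
     (THE c. \<exists>X \<in> carrier_mat 4 4. \<rho> = X * mat_adjoint X \<and> c = concurrence_via X)"

end

theory Submission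
  imports Defs
begin

text \<open>
  For \<open>\<rho> = X X\<^sup>\<dagger>\<close> and \<open>M = X\<^sup>T \<Sigma> X\<close> with \<open>\<Sigma> = \<sigma>\<^sub>y \<otimes> \<sigma>\<^sub>y\<close>, the matrix \<open>M\<^sup>\<dagger> M\<close> has the same
  characteristic polynomial as \<open>\<Sigma>\<^sup>\<dagger> \<rho>\<^sup>* \<Sigma> \<rho>\<close> since \<open>PQ\<close> and \<open>QP\<close> have the same characteristic
  polynomial; hence the concurrence does not depend on \<open>X\<close>. Such an \<open>X\<close> exists by the Cholesky
  decomposition. Writing \<open>K = A \<otimes> B\<close> and \<open>t\<close> for the trace of \<open>K \<rho> K\<^sup>\<dagger>\<close>, the normalised state is
  \<open>X' X'\<^sup>\<dagger>\<close> for \<open>X' = K X / \<surd>t\<close>. From \<open>A\<^sup>T \<sigma>\<^sub>y A = det A \<sigma>\<^sub>y\<close> it follows that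
  \<open>X'\<^sup>T \<Sigma> X' = (det A det B / t) M\<close>, so all singular values are multiplied by the same factor.
\<close>

section \<open>Adjoint, transpose and Kronecker product\<close>

lemma mat_adjoint_dim [simp]: "dim_row (mat_adjoint A) = dim_col A" "dim_col (mat_adjoint A) = dim_row A"
  by (auto simp: mat_adjoint_def)

lemma mat_adjoint_carrier [simp]: "A \<in> carrier_mat m n \<Longrightarrow> mat_adjoint A \<in> carrier_mat n m"
  by auto

lemma mat_adjoint_index [simp]:
  "i < dim_col A \<Longrightarrow> j < dim_row A \<Longrightarrow> mat_adjoint A $$ (i, j) = conjugate (A $$ (j, i))"
  by (simp add: mat_adjoint_def mat_of_rows_def)

lemma mat_mult_index_sum:
  assumes "A \<in> carrier_mat m n" "B \<in> carrier_mat n p" "i < m" "j < p"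
  shows "(A * B) $$ (i, j) = (\<Sum>k<n. A $$ (i, k) * B $$ (k, j))"
  using assms by (auto simp: scalar_prod_def atLeast0LessThan intro!: sum.cong)

lemma mat_adjoint_mult:
  fixes A B :: "complex mat"
  assumes A: "A \<in> carrier_mat m n" and B: "B \<in> carrier_mat n p"
  shows "mat_adjoint (A * B) = mat_adjoint B * mat_adjoint A"
proof (rule eq_matI)
  fix i j assume "i < dim_row (mat_adjoint B * mat_adjoint A)" "j < dim_col (mat_adjoint B * mat_adjoint A)"
  then have ij: "i < p" "j < m" using A B by auto
  have "mat_adjoint (A * B) $$ (i, j) = cnj ((A * B) $$ (j, i))"
    using ij A B by (subst mat_adjoint_index) auto
  also have "\<dots> = (mat_adjoint B * mat_adjoint A) $$ (i, j)"
    using ij A B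
    by (subst mat_mult_index_sum[OF A B], simp, simp,
        subst mat_mult_index_sum[OF mat_adjoint_carrier[OF B] mat_adjoint_carrier[OF A]])
      (auto simp: mult.commute intro!: sum.cong)
  finally show "mat_adjoint (A * B) $$ (i, j) = (mat_adjoint B * mat_adjoint A) $$ (i, j)" .
qed (use A B in auto)

lemma mat_adjoint_smult:
  fixes A :: "complex mat"
  shows "mat_adjoint (c \<cdot>\<^sub>m A) = cnj c \<cdot>\<^sub>m mat_adjoint A"
  by (rule eq_matI) auto

lemma kron_carrier [simp]:
  "A \<in> carrier_mat m n \<Longrightarrow> B \<in> carrier_mat p q \<Longrightarrow> A \<otimes>\<^sub>m B \<in> carrier_mat (m * p) (n * q)"
  by (auto simp: kron_def)

lemma kron_dim [simp]:
  "dim_row (A \<otimes>\<^sub>m B) = dim_row A * dim_row B" "dim_col (A \<otimes>\<^sub>m B) = dim_col A * dim_col B"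
  by (auto simp: kron_def)

lemma kron_index:
  "i < dim_row A * dim_row B \<Longrightarrow> j < dim_col A * dim_col B \<Longrightarrow>
   (A \<otimes>\<^sub>m B) $$ (i, j) = A $$ (i div dim_row B, j div dim_col B) * B $$ (i mod dim_row B, j mod dim_col B)"
  by (simp add: kron_def)

lemma div_mod_less_mult:
  fixes i m n :: nat
  assumes "i < m * n"
  shows "i div n < m" "i mod n < n"
  using assms by (auto simp: less_mult_imp_div_less intro!: mod_less_divisor gr0I)

lemma mat_adjoint_kron: "mat_adjoint (A \<otimes>\<^sub>m B) = mat_adjoint A \<otimes>\<^sub>m mat_adjoint B"
  by (rule eq_matI) (auto simp: kron_index div_mod_less_mult)

lemma transpose_kron: "transpose_mat (A \<otimes>\<^sub>m B) = transpose_mat A \<otimes>\<^sub>m transpose_mat B"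
  by (rule eq_matI) (auto simp: kron_index div_mod_less_mult)

lemma kron_smult: "(c \<cdot>\<^sub>m A) \<otimes>\<^sub>m (d \<cdot>\<^sub>m B) = (c * d) \<cdot>\<^sub>m (A \<otimes>\<^sub>m B)"
  by (rule eq_matI) (auto simp: kron_index div_mod_less_mult)

lemma smult_smult_mat: "c \<cdot>\<^sub>m (d \<cdot>\<^sub>m A) = (c * d) \<cdot>\<^sub>m (A :: complex mat)"
  by (rule eq_matI) auto

text \<open>The range \<open>{..<m * n}\<close> is cut into \<open>m\<close> blocks of length
  \<open>n\<close>. This decodes the summation index of a product of Kronecker products into a
  pair.\<close>

lemma sum_div_mod:
  fixes f :: "nat \<Rightarrow> nat \<Rightarrow> 'a::comm_monoid_add"
  shows "(\<Sum>k<m * n. f (k div n) (k mod n)) = (\<Sum>i<m. \<Sum>j<n. f i j)"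
proof -
  have "(\<Sum>k<m * n. f (k div n) (k mod n)) = (\<Sum>i<m. \<Sum>k\<in>{i * n..<i * n + n}. f (k div n) (k mod n))"
    by (rule sum.nat_group[symmetric])
  also have "\<dots> = (\<Sum>i<m. \<Sum>j<n. f i j)"
  proof (rule sum.cong[OF refl])
    fix i
    have "(\<Sum>k\<in>{i * n..<i * n + n}. f (k div n) (k mod n)) =
        (\<Sum>j\<in>{0..<n}. f ((j + i * n) div n) ((j + i * n) mod n))"
      using sum.shift_bounds_nat_ivl[of "\<lambda>k. f (k div n) (k mod n)" 0 "i * n" n] by (simp add: add.commute)
    also have "\<dots> = (\<Sum>j<n. f i j)"
      by (auto simp: atLeast0LessThan intro!: sum.cong)
    finally show "(\<Sum>k\<in>{i * n..<i * n + n}. f (k div n) (k mod n)) = (\<Sum>j<n. f i j)" .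
  qed
  finally show ?thesis .
qed

text \<open>Mixed-product rule: after decoding the middle index, the double sum is a product of two
  single sums, one for each tensor factor.\<close>

lemma kron_mult:
  assumes A: "A \<in> carrier_mat m n" and C: "C \<in> carrier_mat n p"
    and B: "B \<in> carrier_mat m' n'" and D: "D \<in> carrier_mat n' p'"
  shows "(A \<otimes>\<^sub>m B) * (C \<otimes>\<^sub>m D) = (A * C) \<otimes>\<^sub>m (B * D)"
proof (rule eq_matI)
  fix i j assume "i < dim_row ((A * C) \<otimes>\<^sub>m (B * D))" "j < dim_col ((A * C) \<otimes>\<^sub>m (B * D))"
  then have ij: "i < m * m'" "j < p * p'" using assms by auto
  note ij' = div_mod_less_mult[OF ij(1)] div_mod_less_mult[OF ij(2)]
  have "((A \<otimes>\<^sub>m B) * (C \<otimes>\<^sub>m D)) $$ (i, j) =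
      (\<Sum>k<n * n'. A $$ (i div m', k div n') * B $$ (i mod m', k mod n') *
        (C $$ (k div n', j div p') * D $$ (k mod n', j mod p')))"
    using assms ij
    by (subst mat_mult_index_sum[OF kron_carrier[OF A B] kron_carrier[OF C D]])
      (auto simp: kron_index intro!: sum.cong)
  also have "\<dots> = (\<Sum>k<n. \<Sum>l<n'. A $$ (i div m', k) * B $$ (i mod m', l) *
        (C $$ (k, j div p') * D $$ (l, j mod p')))"
    by (rule sum_div_mod)
  also have "\<dots> = (A * C) $$ (i div m', j div p') * (B * D) $$ (i mod m', j mod p')"
    unfolding mat_mult_index_sum[OF A C ij'(1,3)] mat_mult_index_sum[OF B D ij'(2,4)] sum_product
    by (intro sum.cong refl) (simp add: mult_ac)
  also have "\<dots> = ((A * C) \<otimes>\<^sub>m (B * D)) $$ (i, j)"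
    using assms ij by (subst kron_index) (auto simp del: index_mult_mat(1))
  finally show "((A \<otimes>\<^sub>m B) * (C \<otimes>\<^sub>m D)) $$ (i, j) = ((A * C) \<otimes>\<^sub>m (B * D)) $$ (i, j)" .
qed (use assms in auto)

section \<open>Traces of products\<close>

lemma trace_mult_comm:
  assumes A: "A \<in> carrier_mat m n" and B: "B \<in> carrier_mat n m"
  shows "trace (A * B) = trace (B * A)"
proof -
  have "trace (A * B) = (\<Sum>i<m. \<Sum>k<n. A $$ (i, k) * B $$ (k, i))"
    using A by (auto simp: trace_def mat_mult_index_sum[OF A B] simp del: index_mult_mat(1) intro!: sum.cong)
  also have "\<dots> = (\<Sum>k<n. \<Sum>i<m. B $$ (k, i) * A $$ (i, k))"
    by (subst sum.swap) (simp add: mult.commute)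
  also have "\<dots> = trace (B * A)"
    using B by (auto simp: trace_def mat_mult_index_sum[OF B A] simp del: index_mult_mat(1) intro!: sum.cong)
  finally show ?thesis .
qed

text \<open>The squared Frobenius norm exhibits the normalising trace as a nonnegative real, so that
  its square root can be used.\<close>

lemma trace_mult_adjoint:
  fixes Y :: "complex mat"
  assumes Y: "Y \<in> carrier_mat m n"
  shows "trace (Y * mat_adjoint Y) = complex_of_real (\<Sum>i<m. \<Sum>k<n. (cmod (Y $$ (i, k)))\<^sup>2)"
proof -
  have "(Y * mat_adjoint Y) $$ (i, i) = complex_of_real (\<Sum>k<n. (cmod (Y $$ (i, k)))\<^sup>2)" if "i < m" for i
    using Y that
    by (subst mat_mult_index_sum[OF Y mat_adjoint_carrier[OF Y]])
      (auto simp: complex_norm_square simp del: of_real_power intro!: sum.cong)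
  then show ?thesis
    using Y by (simp add: trace_def del: index_mult_mat(1))
qed

section \<open>Characteristic polynomials and singular values\<close>

text \<open>The block matrices \<open>?M\<close> and \<open>?N\<close> are similar through the
  unipotent \<open>?P\<close>. Both are block lower triangular with one zero diagonal block, so
  comparing their characteristic polynomials leaves a common factor \<open>char_poly ?O\<close> to
  cancel.\<close>

lemma char_poly_mult_comm:
  fixes A B :: "complex mat"
  assumes A: "A \<in> carrier_mat n n" and B: "B \<in> carrier_mat n n"
  shows "char_poly (A * B) = char_poly (B * A)"
proof -
  let ?O = "0\<^sub>m n n :: complex mat" and ?I = "1\<^sub>m n :: complex mat"
  let ?P = "four_block_mat ?I A ?O ?I" and ?Q = "four_block_mat ?I (- A) ?O ?I"
  let ?M = "four_block_mat (A * B) ?O B ?O" and ?N = "four_block_mat ?O ?O B (B * A)"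
  have fact: "\<exists>es. char_poly M = (\<Prod>a\<leftarrow>es. [:- a, 1:])" if "M \<in> carrier_mat n n" for M :: "complex mat"
    using char_poly_factorized[OF that] by blast
  have id2: "four_block_mat ?I ?O ?O ?I = 1\<^sub>m (n + n)"
    by (rule eq_matI) auto
  have uminus: "A + - A = ?O" "- A + A = ?O" and uminus_zero: "- ?O + ?I = ?I"
    using A by (auto intro!: eq_matI)
  have PQ: "?P * ?Q = 1\<^sub>m (n + n)" "?Q * ?P = 1\<^sub>m (n + n)"
    using A by (simp_all add: mult_four_block_mat[of _ n n _ n _ n _ _ n _ n] uminus id2 uminus_zero)
  have "?P * ?N = four_block_mat (A * B) (A * (B * A)) B (B * A)"
    using A B by (subst mult_four_block_mat[of _ n n _ n _ n _ _ n _ n]) auto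
  also have "\<dots> = four_block_mat (A * B) (A * B * A) B (B * A)"
    using A B by (simp add: assoc_mult_mat)
  also have "\<dots> = ?M * ?P"
    using A B by (subst mult_four_block_mat[of _ n n _ n _ n _ _ n _ n]) auto
  finally have "?P * ?N = ?M * ?P" .
  moreover have carr: "?M \<in> carrier_mat (n + n) (n + n)" "?N \<in> carrier_mat (n + n) (n + n)"
     "?P \<in> carrier_mat (n + n) (n + n)" "?Q \<in> carrier_mat (n + n) (n + n)"
    using A B by auto
  ultimately have "?M = ?P * ?N * ?Q"
    by (simp only: assoc_mult_mat[of _ "n + n" "n + n" _ "n + n" _ "n + n"] PQ right_mult_one_mat)
  then have "similar_mat ?M ?N"
    unfolding similar_mat_def similar_mat_wit_def Let_def
    by (intro exI[of _ ?P, OF exI[of _ ?Q]]) (use PQ carr in \<open>simp only:, auto\<close>)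
  then have "char_poly ?M = char_poly ?N"
    by (rule char_poly_similar)
  moreover have "char_poly ?M = char_poly (A * B) * char_poly ?O"
    by (rule char_poly_0_block'[OF refl]) (use A B fact in auto)
  moreover have "char_poly ?N = char_poly ?O * char_poly (B * A)"
    by (rule char_poly_0_block'[OF refl]) (use A B fact in auto)
  \<comment> \<open>A monic polynomial is nonzero, which permits the cancellation.\<close>
  moreover have "char_poly ?O \<noteq> 0"
    using degree_monic_char_poly[of ?O n] by auto
  ultimately show ?thesis by simp
qed

lemma proots_linear_factors: "proots (\<Prod>a\<leftarrow>es. [:- a, 1:]) = mset (es :: complex list)"
proof (induction es)
  case (Cons a es)
  have "(\<Prod>a\<leftarrow>es. [:- a, 1:]) \<noteq> (0 :: complex poly)"
    by (simp add: prod_list_zero_iff image_iff)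
  with Cons show ?case by (simp add: proots_mult del: mult_pCons_left)
qed auto

text \<open>By Schur triangularisation the roots are diagonal entries, and scaling preserves both
  similarity and triangularity. This argument includes \<open>c = 0\<close>.\<close>

lemma proots_char_poly_smult:
  fixes N :: "complex mat"
  assumes N: "N \<in> carrier_mat n n"
  shows "proots (char_poly (c \<cdot>\<^sub>m N)) = image_mset ((*) c) (proots (char_poly N))"
proof -
  obtain es where es: "char_poly N = (\<Prod>a\<leftarrow>es. [:- a, 1:])"
    using char_poly_factorized[OF N] by blast
  obtain T where T: "T \<in> carrier_mat n n" "upper_triangular T" "similar_mat N T"
    using schur_decomposition_exists[OF N es] by blast
  have cT: "c \<cdot>\<^sub>m T \<in> carrier_mat n n" "upper_triangular (c \<cdot>\<^sub>m T)"
    using T by (auto simp: upper_triangular_def)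
  have diag: "diag_mat (c \<cdot>\<^sub>m T) = map ((*) c) (diag_mat T)"
    using T by (auto simp: diag_mat_def)
  have "char_poly N = (\<Prod>a\<leftarrow>diag_mat T. [:- a, 1:])"
    using char_poly_similar[OF T(3)] char_poly_upper_triangular[OF T(1,2)] by simp
  moreover have "char_poly (c \<cdot>\<^sub>m N) = (\<Prod>a\<leftarrow>diag_mat (c \<cdot>\<^sub>m T). [:- a, 1:])"
    using char_poly_similar[OF similar_mat_smult[OF T(3)]] char_poly_upper_triangular[OF cT] by simp
  ultimately show ?thesis
    by (simp only: proots_linear_factors diag mset_map)
qed

lemma sort_map_mult:
  fixes k :: real
  assumes "0 \<le> k"
  shows "sort (map ((*) k) xs) = map ((*) k) (sort xs)"
proof (rule properties_for_sort)
  show "sorted (map ((*) k) (sort xs))"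
    using assms by (auto simp: sorted_map intro!: sorted_wrt_mono_rel[OF _ sorted_sort] mult_left_mono)
qed simp

lemma singular_values_smult:
  assumes M: "M \<in> carrier_mat n n"
  shows "singular_values (c \<cdot>\<^sub>m M) = map ((*) (cmod c)) (singular_values M)"
proof -
  let ?N = "mat_adjoint M * M"
  obtain es where es: "proots (char_poly ?N) = mset es" using ex_mset by metis
  have N: "?N \<in> carrier_mat n n" using M by auto
  have "mat_adjoint (c \<cdot>\<^sub>m M) * (c \<cdot>\<^sub>m M) = complex_of_real ((cmod c)\<^sup>2) \<cdot>\<^sub>m ?N"
    unfolding mat_adjoint_smult mult_smult_assoc_mat[OF mat_adjoint_carrier[OF M] smult_carrier_mat[OF M]]
      mult_smult_distrib[OF mat_adjoint_carrier[OF M] M]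
    by (rule eq_matI) (auto simp: complex_norm_square mult_ac simp del: of_real_power index_mult_mat(1))
  then have "proots (char_poly (mat_adjoint (c \<cdot>\<^sub>m M) * (c \<cdot>\<^sub>m M))) =
      mset (map ((*) (complex_of_real ((cmod c)\<^sup>2))) es)"
    using es proots_char_poly_smult[OF N] by simp
  then have "singular_values (c \<cdot>\<^sub>m M) =
      rev (sort (map (\<lambda>z. sqrt (Re z)) (map ((*) (complex_of_real ((cmod c)\<^sup>2))) es)))"
    unfolding singular_values_def by (simp only: mset_map[symmetric] sorted_list_of_multiset_mset)
  \<comment> \<open>\<open>sqrt\<close> is multiplicative on all reals, so the sign of
    \<open>Re z\<close> does not matter here.\<close>
  also have "map (\<lambda>z. sqrt (Re z)) (map ((*) (complex_of_real ((cmod c)\<^sup>2))) es) =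
      map ((*) (cmod c)) (map (\<lambda>z. sqrt (Re z)) es)"
    by (simp add: real_sqrt_mult del: of_real_power)
  also have "rev (sort \<dots>) = map ((*) (cmod c)) (singular_values M)"
    unfolding singular_values_def es mset_map[symmetric] sorted_list_of_multiset_mset
    by (simp only: sort_map_mult[OF norm_ge_zero] rev_map)
  finally show ?thesis .
qed

text \<open>Over the complex numbers a polynomial has as many roots as its degree. This justifies
  the list indices 0 to 3 in the concurrence.\<close>

lemma length_singular_values:
  assumes M: "M \<in> carrier_mat n n"
  shows "length (singular_values M) = n"
proof -
  have "mat_adjoint M * M \<in> carrier_mat n n" using M by auto
  then have "degree (char_poly (mat_adjoint M * M)) = n"
    using degree_monic_char_poly by blast
  then show ?thesis
    by (simp add: singular_values_def size_mset[symmetric] size_proots_complex del: size_mset)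
qed

section \<open>Cholesky decomposition\<close>

text \<open>Induction on the size: the last row and column are split off and the Schur complement is
  again positive semidefinite. Entries are functions on indices, so passing to the leading block
  needs no change of type or dimension.\<close>

lemma cholesky_fun:
  fixes f :: "nat \<Rightarrow> nat \<Rightarrow> complex"
  assumes "\<And>r s. r < n \<Longrightarrow> s < n \<Longrightarrow> f s r = cnj (f r s)"
    and "\<And>v. 0 \<le> Re (\<Sum>r<n. \<Sum>s<n. cnj (v r) * f r s * v s)"
  shows "\<exists>X. \<forall>r<n. \<forall>s<n. f r s = (\<Sum>c<n. X r c * cnj (X s c))"
  using assms
proof (induction n arbitrary: f)
  case (Suc n)
  note herm = Suc.prems(1) and pos = Suc.prems(2)
  define a where "a = Re (f n n)"
  define L where "L v = (\<Sum>s<n. f n s * v s)" for v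
  define Q where "Q v = (\<Sum>r<n. \<Sum>s<n. cnj (v r) * f r s * v s)" for v
  have fnn: "f n n = of_real a"
    using herm[of n n] by (simp add: a_def complex_eq_iff)
  have fsn: "cnj (f s n) = f n s" if "s < n" for s
    using herm[of s n] that by simp
  have cnj_L: "(\<Sum>r<n. cnj (v r) * f r n) = cnj (L v)" for v
    unfolding L_def cnj_sum by (intro sum.cong refl) (use herm[of _ n] in \<open>simp add: mult.commute\<close>)
  \<comment> \<open>The form is evaluated at \<open>v\<close> with last coordinate \<open>z\<close>;
    different choices of \<open>z\<close> give all the facts about the last column.\<close>
  have expand: "0 \<le> Re (Q v) + 2 * Re (cnj z * L v) + (cmod z)\<^sup>2 * a" for v z
  proof -
    let ?w = "v(n := z)"
    have "(\<Sum>r<Suc n. \<Sum>s<Suc n. cnj (?w r) * f r s * ?w s) =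
        Q v + (\<Sum>r<n. cnj (v r) * f r n * z) + (\<Sum>s<n. cnj z * f n s * v s) + cnj z * f n n * z"
      unfolding Q_def by (simp add: sum.distrib algebra_simps)
    also have "\<dots> = Q v + cnj (cnj z * L v) + cnj z * L v + of_real ((cmod z)\<^sup>2 * a)"
      by (simp add: cnj_L[symmetric] sum_distrib_right[symmetric] fnn complex_norm_square del: of_real_power)
        (simp add: L_def sum_distrib_left mult_ac)
    finally have eq: "(\<Sum>r<Suc n. \<Sum>s<Suc n. cnj (?w r) * f r s * ?w s) =
        Q v + cnj (cnj z * L v) + cnj z * L v + of_real ((cmod z)\<^sup>2 * a)" .
    show ?thesis
      using pos[of ?w] unfolding eq by simp
  qed
  have a: "0 \<le> a"
    using expand[of "\<lambda>_. 0" 1] by (simp add: Q_def L_def)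
  have zero: "f r n = 0" if "a = 0" "r < n" for r
  proof (rule ccontr)
    assume nz: "f r n \<noteq> 0"
    let ?v = "\<lambda>s. if s = r then 1 else 0 :: complex"
    have L: "L ?v = f n r"
      using that by (simp add: L_def if_distrib[where f = "\<lambda>x. _ * x"] cong: if_cong)
    have nz': "f n r \<noteq> 0" using nz fsn[OF that(2)] by auto
    \<comment> \<open>With \<open>a = 0\<close> the form is affine along multiples of
      \<open>f n r\<close>. This \<open>t\<close> makes its value
      \<open>Re (Q ?v) - 2 * (\<bar>Re (Q ?v)\<bar> + 1)\<close>, which is negative.\<close>
    define t where "t = (\<bar>Re (Q ?v)\<bar> + 1) / (cmod (f n r))\<^sup>2"
    have "Re (cnj (- of_real t * f n r) * f n r) = - (t * (cmod (f n r))\<^sup>2)"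
      unfolding cmod_power2 by (simp add: power2_eq_square algebra_simps)
    also have "\<dots> = - (\<bar>Re (Q ?v)\<bar> + 1)"
      using nz' by (simp add: t_def)
    finally show False
      using expand[of ?v "- of_real t * f n r"] that L by simp
  qed
  \<comment> \<open>The Schur complement of the entry \<open>a\<close>; for \<open>a = 0\<close>
    division by zero yields 0 and \<open>g\<close> is \<open>f\<close>.\<close>
  define g where "g r s = f r s - f r n * cnj (f s n) / of_real a" for r s
  have "\<exists>Y. \<forall>r<n. \<forall>s<n. g r s = (\<Sum>c<n. Y r c * cnj (Y s c))"
  proof (rule Suc.IH)
    show "g s r = cnj (g r s)" if "r < n" "s < n" for r s
      using herm[of r s] that by (simp add: g_def mult.commute)
    show "0 \<le> Re (\<Sum>r<n. \<Sum>s<n. cnj (v r) * g r s * v s)" for v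
    proof -
      have "(\<Sum>r<n. \<Sum>s<n. cnj (v r) * g r s * v s) =
          Q v - (\<Sum>r<n. \<Sum>s<n. (cnj (v r) * f r n) * (f n s * v s) / of_real a)"
        unfolding Q_def sum_subtractf[symmetric]
        by (intro sum.cong refl) (simp add: g_def fsn algebra_simps)
      also have "(\<Sum>r<n. \<Sum>s<n. (cnj (v r) * f r n) * (f n s * v s) / of_real a) = cnj (L v) * L v / of_real a"
        unfolding cnj_L[symmetric] sum_divide_distrib[symmetric] sum_product[symmetric] by (simp add: L_def)
      also have "cnj (L v) * L v / of_real a = of_real ((cmod (L v))\<^sup>2 / a)"
        by (simp add: complex_norm_square mult.commute del: of_real_power)
      finally have eq: "Re (\<Sum>r<n. \<Sum>s<n. cnj (v r) * g r s * v s) = Re (Q v) - (cmod (L v))\<^sup>2 / a"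
        by simp
      \<comment> \<open>For \<open>a > 0\<close> this \<open>z\<close> minimises the form, and the
        minimum is the form of \<open>g\<close> at \<open>v\<close>. For \<open>a = 0\<close> it is
        0.\<close>
      let ?z = "- L v / of_real a"
      have "Re (cnj ?z * L v) = - ((cmod (L v))\<^sup>2 / a)"
        unfolding cmod_power2 by (simp add: power2_eq_square add_divide_distrib)
      moreover have "(cmod ?z)\<^sup>2 * a = (cmod (L v))\<^sup>2 / a"
        by (simp add: norm_divide power_divide power2_eq_square)
      ultimately show ?thesis
        using expand[of v ?z] unfolding eq by linarith
    qed
  qed
  then obtain Y where Y: "g r s = (\<Sum>c<n. Y r c * cnj (Y s c))" if "r < n" "s < n" for r s
    by blast
  \<comment> \<open>Column \<open>n\<close> supplies the rank-one term removed in \<open>g\<close>.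
    Row \<open>n\<close> vanishes outside that column, so it does not disturb the factorisation by
    \<open>Y\<close>.\<close>
  define X where "X r c = (if c = n then f r n / of_real (sqrt a) else if r = n then 0 else Y r c)" for r c
  have sq: "complex_of_real (sqrt a) * complex_of_real (sqrt a) = of_real a"
    using a by (simp flip: of_real_mult)
  have "f r s = (\<Sum>c<Suc n. X r c * cnj (X s c))" if "r < Suc n" "s < Suc n" for r s
  proof -
    have "(\<Sum>c<Suc n. X r c * cnj (X s c)) =
        (if r = n \<or> s = n then 0 else g r s) + f r n * cnj (f s n) / of_real a"
      using that Y[of r s] by (auto simp: X_def sq less_Suc_eq)
    also have "\<dots> = f r s"
    proof (cases "r = n \<or> s = n")
      case True
      \<comment> \<open>For \<open>a = 0\<close> the quotient is 0 and so are the border entries, by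
        \<open>zero\<close>; otherwise \<open>f n n = a\<close> cancels the denominator.\<close>
      then show ?thesis
        using that fnn zero[of r] zero[of s] fsn[of s] by (cases "a = 0") (auto simp: less_Suc_eq)
    qed (simp add: g_def)
    finally show ?thesis by simp
  qed
  then show ?case by blast
qed simp

lemma psd_cholesky:
  assumes M: "M \<in> carrier_mat n n" and psd: "psd M"
  shows "\<exists>X \<in> carrier_mat n n. M = X * mat_adjoint X"
proof -
  have "\<exists>X. \<forall>r<n. \<forall>s<n. M $$ (r, s) = (\<Sum>c<n. X r c * cnj (X s c))"
  proof (rule cholesky_fun)
    show "M $$ (s, r) = cnj (M $$ (r, s))" if "r < n" "s < n" for r s
      using mat_adjoint_index[of s M r] psd M that unfolding psd_def by simp
    show "0 \<le> Re (\<Sum>r<n. \<Sum>s<n. cnj (v r) * M $$ (r, s) * v s)" for v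
    proof -
      have "0 \<le> (M *\<^sub>v vec n v) \<bullet>c vec n v"
        using psd M by (auto simp: psd_def)
      also have "(M *\<^sub>v vec n v) \<bullet>c vec n v = (\<Sum>r<n. \<Sum>s<n. cnj (v r) * M $$ (r, s) * v s)"
        using M by (auto simp: scalar_prod_def atLeast0LessThan sum_distrib_left sum_distrib_right mult_ac intro!: sum.cong)
      finally show ?thesis by (simp add: less_eq_complex_def)
    qed
  qed
  then obtain X where X: "M $$ (r, s) = (\<Sum>c<n. X r c * cnj (X s c))" if "r < n" "s < n" for r s
    by blast
  let ?X = "mat n n (\<lambda>(r, c). X r c)"
  have "M = ?X * mat_adjoint ?X"
    by (rule eq_matI) (use M X in \<open>auto simp: scalar_prod_def atLeast0LessThan intro!: sum.cong\<close>)
  then show ?thesis by (intro bexI[of _ ?X]) auto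
qed

section \<open>Concurrence\<close>

lemma sigma_y_carrier [simp]: "sigma_y \<in> carrier_mat 2 2"
  by (rule carrier_matI) (simp_all add: sigma_y_def mat_of_rows_list_def)

lemma sigma_yy_carrier [simp]: "sigma_y \<otimes>\<^sub>m sigma_y \<in> carrier_mat 4 4"
  using kron_carrier[OF sigma_y_carrier sigma_y_carrier] by simp

section \<open>Congruence action on sigma_y\<close>

lemma det_2:
  assumes A: "A \<in> carrier_mat 2 2"
  shows "det A = A $$ (0, 0) * A $$ (1, 1) - A $$ (0, 1) * A $$ (1, 0)"
proof -
  have "det A = (\<Sum>i<2. A $$ (i, 0) * cofactor A i 0)"
    using laplace_expansion_column[OF A, of 0] by simp
  moreover have "det (mat_delete A i 0) = A $$ (1 - i, 1)" if "i < 2" for i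
    using A that by (subst det_single) (auto simp: mat_delete_def)
  ultimately show ?thesis
    by (simp add: cofactor_def lessThan_nat_numeral lessThan_Suc numeral_2_eq_2)
qed

text \<open>\<open>sigma_y\<close> is antisymmetric, and alternating bilinear forms on a plane are
  unique up to a factor; a change of basis multiplies them by the determinant.\<close>

lemma transpose_sigma_y_mult:
  assumes A: "A \<in> carrier_mat 2 2"
  shows "transpose_mat A * sigma_y * A = det A \<cdot>\<^sub>m sigma_y"
proof (rule eq_matI)
  fix i j assume "i < dim_row (det A \<cdot>\<^sub>m sigma_y)" "j < dim_col (det A \<cdot>\<^sub>m sigma_y)"
  then have "i \<in> {0, 1}" "j \<in> {0, 1}" by (auto simp: sigma_y_def mat_of_rows_list_def)
  then show "(transpose_mat A * sigma_y * A) $$ (i, j) = (det A \<cdot>\<^sub>m sigma_y) $$ (i, j)"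
    using A by (auto simp: det_2[OF A] scalar_prod_def sigma_y_def mat_of_rows_list_def
        numeral_2_eq_2 algebra_simps)
qed (use A in \<open>auto simp: sigma_y_def mat_of_rows_list_def\<close>)

lemma concurrence_via_cong:
  assumes X: "X \<in> carrier_mat 4 4" and Y: "Y \<in> carrier_mat 4 4"
    and eq: "X * mat_adjoint X = Y * mat_adjoint Y"
  shows "concurrence_via X = concurrence_via Y"
proof -
  let ?S = "sigma_y \<otimes>\<^sub>m sigma_y"
  let ?R = "\<lambda>X. transpose_mat (mat_adjoint X) * transpose_mat X"
  have cp: "char_poly (mat_adjoint (transpose_mat X * ?S * X) * (transpose_mat X * ?S * X)) =
      char_poly (mat_adjoint ?S * transpose_mat (X * mat_adjoint X) * ?S * (X * mat_adjoint X))"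
    if X: "X \<in> carrier_mat 4 4" for X
  proof -
    note [simp] = assoc_mult_mat[of _ 4 4 _ 4 _ 4] mult_carrier_mat[of _ 4 4 _ 4]
    have tX: "transpose_mat X \<in> carrier_mat 4 4" "mat_adjoint X \<in> carrier_mat 4 4"
      "mat_adjoint (transpose_mat X) \<in> carrier_mat 4 4" "transpose_mat (mat_adjoint X) \<in> carrier_mat 4 4"
      "mat_adjoint ?S \<in> carrier_mat 4 4" using X by (simp_all del: kron_dim)
    note car = X tX sigma_yy_carrier
    have "mat_adjoint (transpose_mat X) = transpose_mat (mat_adjoint X)"
      by (rule eq_matI) auto
    then have "mat_adjoint (transpose_mat X * ?S * X) * (transpose_mat X * ?S * X) =
        mat_adjoint X * (mat_adjoint ?S * (?R X) * ?S * X)"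
      using car by (simp add: mat_adjoint_mult[of _ 4 4 _ 4])
    \<comment> \<open>Cycling the leading adjoint of \<open>X\<close> to the end leaves
      \<open>X\<close> only in the product with its adjoint and in the transpose of that
      product.\<close>
    also have "char_poly \<dots> = char_poly ((mat_adjoint ?S * (?R X) * ?S * X) * mat_adjoint X)"
      by (rule char_poly_mult_comm[of _ 4]) (use car in auto)
    also have "(mat_adjoint ?S * (?R X) * ?S * X) * mat_adjoint X =
        mat_adjoint ?S * (?R X) * ?S * (X * mat_adjoint X)"
      using car by simp
    also have "?R X = transpose_mat (X * mat_adjoint X)"
      using car by (simp add: transpose_mult[of _ 4 4 _ 4])
    finally show ?thesis .
  qed
  show ?thesis
    unfolding concurrence_via_def singular_values_def cp[OF X] cp[OF Y] eq ..
qed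

text \<open>Resolves the definite description: \<open>X\<close> itself is a witness, and
  \<open>concurrence_via_cong\<close> gives uniqueness.\<close>

lemma concurrence_mult_adjoint:
  assumes X: "X \<in> carrier_mat 4 4"
  shows "concurrence (X * mat_adjoint X) = concurrence_via X"
  unfolding concurrence_def
proof (rule the_equality)
  show "\<exists>Y \<in> carrier_mat 4 4. X * mat_adjoint X = Y * mat_adjoint Y \<and> concurrence_via X = concurrence_via Y"
    using X by blast
next
  fix c assume "\<exists>Y \<in> carrier_mat 4 4. X * mat_adjoint X = Y * mat_adjoint Y \<and> c = concurrence_via Y"
  then obtain Y where "Y \<in> carrier_mat 4 4" "X * mat_adjoint X = Y * mat_adjoint Y" "c = concurrence_via Y"
    by blast
  then show "c = concurrence_via X"
    using concurrence_via_cong[OF X, of Y] by simp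
qed

text \<open>The common factor \<open>cmod c\<close> is nonnegative, so it passes through the
  difference and through the maximum with 0.\<close>

lemma concurrence_via_scale:
  assumes X: "X \<in> carrier_mat 4 4" and Y: "Y \<in> carrier_mat 4 4"
    and eq: "transpose_mat Y * (sigma_y \<otimes>\<^sub>m sigma_y) * Y =
      c \<cdot>\<^sub>m (transpose_mat X * (sigma_y \<otimes>\<^sub>m sigma_y) * X)"
  shows "concurrence_via Y = cmod c * concurrence_via X"
proof -
  let ?M = "transpose_mat X * (sigma_y \<otimes>\<^sub>m sigma_y) * X"
  have M: "?M \<in> carrier_mat 4 4"
    using X sigma_yy_carrier by (meson mult_carrier_mat transpose_carrier_mat)
  let ?s = "singular_values ?M"
  have "concurrence_via Y = max 0 (cmod c * (?s ! 0 - ?s ! 1 - ?s ! 2 - ?s ! 3))"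
    unfolding concurrence_via_def eq singular_values_smult[OF M] Let_def
    using length_singular_values[OF M] by (simp add: right_diff_distrib)
  also have "\<dots> = cmod c * concurrence_via X"
    unfolding concurrence_via_def Let_def by (simp add: max_mult_distrib_left)
  finally show ?thesis .
qed

section \<open>Local filtering of a two-qubit state\<close>

theorem theorem1:
  fixes \<rho> \<rho>' A B :: "complex mat"
  assumes "two_qubit_density \<rho>"
    and "A \<in> carrier_mat 2 2" and "B \<in> carrier_mat 2 2"
    and "mat_adjoint A * A \<le>\<^sub>L 1\<^sub>m 2" and "mat_adjoint B * B \<le>\<^sub>L 1\<^sub>m 2"
    and "det A \<noteq> 0" and "det B \<noteq> 0"
    and "\<rho>' = (1 / trace ((A \<otimes>\<^sub>m B) * \<rho> * mat_adjoint (A \<otimes>\<^sub>m B)))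
               \<cdot>\<^sub>m ((A \<otimes>\<^sub>m B) * \<rho> * mat_adjoint (A \<otimes>\<^sub>m B))"
  shows "complex_of_real (concurrence \<rho>') =
           complex_of_real (concurrence \<rho>) *
             (complex_of_real (cmod (det A) * cmod (det B)) /
              trace (((mat_adjoint A * A) \<otimes>\<^sub>m (mat_adjoint B * B)) * \<rho>))"
proof -
  let ?S = "sigma_y \<otimes>\<^sub>m sigma_y"
  note A = \<open>A \<in> carrier_mat 2 2\<close> and B = \<open>B \<in> carrier_mat 2 2\<close>
  define K where "K = A \<otimes>\<^sub>m B"
  have K: "K \<in> carrier_mat 4 4"
    using kron_carrier[OF A B] by (simp add: K_def)
  obtain X where X: "X \<in> carrier_mat 4 4" and \<rho>: "\<rho> = X * mat_adjoint X"
    using assms(1) psd_cholesky unfolding two_qubit_density_def by blast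
  have KX: "K * X \<in> carrier_mat 4 4" using K X by simp
  note [simp] = assoc_mult_mat[of _ 4 4 _ 4 _ 4] mult_carrier_mat[of _ 4 4 _ 4]
  have K\<rho>K: "K * \<rho> * mat_adjoint K = (K * X) * mat_adjoint (K * X)"
    unfolding \<rho> mat_adjoint_mult[OF K X] using K X by simp
  define t where "t = (\<Sum>i<4. \<Sum>k<4. (cmod ((K * X) $$ (i, k)))\<^sup>2)"
  have tr: "trace (K * \<rho> * mat_adjoint K) = complex_of_real t"
    unfolding K\<rho>K t_def by (rule trace_mult_adjoint[OF KX])
  have t: "0 \<le> t" unfolding t_def by (intro sum_nonneg) simp
  have KK: "(mat_adjoint A * A) \<otimes>\<^sub>m (mat_adjoint B * B) = mat_adjoint K * K"
    unfolding K_def mat_adjoint_kron using A B by (simp add: kron_mult[of _ 2 2 _ 2 _ 2 2 _ 2])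
  \<comment> \<open>Cyclicity of the trace identifies the denominator of the claim with the
    normalising trace.\<close>
  have "trace (mat_adjoint K * K * \<rho>) = trace (mat_adjoint K * (K * \<rho>))"
    using K X by (simp add: \<rho>)
  also have "\<dots> = trace (K * \<rho> * mat_adjoint K)"
    by (rule trace_mult_comm[of _ 4 4]) (use K X in \<open>auto simp: \<rho>\<close>)
  finally have tr': "trace (((mat_adjoint A * A) \<otimes>\<^sub>m (mat_adjoint B * B)) * \<rho>) = complex_of_real t"
    unfolding KK tr .
  \<comment> \<open>Scaling \<open>K * X\<close> by \<open>s\<close> scales the state by
    \<open>s * s\<close>, because \<open>s\<close> is real.\<close>
  define s where "s = complex_of_real (1 / sqrt t)"
  \<comment> \<open>This also covers \<open>t = 0\<close>, where all quotients are \<open>0\<close>.\<close>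
  have ss: "s * s = 1 / complex_of_real t"
    using t by (simp add: s_def flip: of_real_mult)
  have "cnj s = s" by (simp add: s_def)
  define Y where "Y = s \<cdot>\<^sub>m (K * X)"
  have Y: "Y \<in> carrier_mat 4 4" using KX by (simp add: Y_def)
  have "\<rho>' = Y * mat_adjoint Y"
    unfolding assms(8) K_def[symmetric] tr ss[symmetric] unfolding K\<rho>K Y_def mat_adjoint_smult \<open>cnj s = s\<close>
      mult_smult_assoc_mat[OF KX smult_carrier_mat[OF mat_adjoint_carrier[OF KX]]]
      mult_smult_distrib[OF KX mat_adjoint_carrier[OF KX]]
    by (simp add: smult_smult_mat)
  then have \<rho>': "concurrence \<rho>' = concurrence_via Y"
    using concurrence_mult_adjoint[OF Y] by simp
  have KSK: "transpose_mat K * ?S * K = (det A * det B) \<cdot>\<^sub>m ?S"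
    unfolding K_def transpose_kron kron_smult[symmetric] transpose_sigma_y_mult[OF A, symmetric]
      transpose_sigma_y_mult[OF B, symmetric]
    using A B by (simp add: kron_mult[of _ 2 2 _ 2 _ 2 2 _ 2])
  have tK: "transpose_mat K \<in> carrier_mat 4 4" and tX: "transpose_mat X \<in> carrier_mat 4 4"
    using K X by auto
  have "transpose_mat (K * X) * ?S * (K * X) = transpose_mat X * (transpose_mat K * ?S * K) * X"
    using K X tK tX sigma_yy_carrier by (simp add: transpose_mult[of _ 4 4 _ 4])
  also have "\<dots> = (det A * det B) \<cdot>\<^sub>m (transpose_mat X * ?S * X)"
    unfolding KSK mult_smult_distrib[OF tX sigma_yy_carrier]
    by (rule mult_smult_assoc_mat[OF mult_carrier_mat[OF tX sigma_yy_carrier] X])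
  finally have "transpose_mat (K * X) * ?S * (K * X) = (det A * det B) \<cdot>\<^sub>m (transpose_mat X * ?S * X)" .
  \<comment> \<open>The expression is bilinear in \<open>Y\<close>, with a transpose and no
    conjugate, so the factor is again \<open>s * s\<close>.\<close>
  moreover have "transpose_mat Y * ?S * Y = (s * s) \<cdot>\<^sub>m (transpose_mat (K * X) * ?S * (K * X))"
  proof -
    have tKX: "transpose_mat (K * X) \<in> carrier_mat 4 4" using KX by simp
    have tY: "transpose_mat Y = s \<cdot>\<^sub>m transpose_mat (K * X)"
      unfolding Y_def by (rule eq_matI) auto
    show ?thesis
      unfolding tY unfolding Y_def mult_smult_assoc_mat[OF tKX sigma_yy_carrier]
        mult_smult_assoc_mat[OF mult_carrier_mat[OF tKX sigma_yy_carrier] smult_carrier_mat[OF KX]]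
        mult_smult_distrib[OF mult_carrier_mat[OF tKX sigma_yy_carrier] KX] smult_smult_mat
      by simp
  qed
  ultimately have "transpose_mat Y * ?S * Y =
      (det A * det B / complex_of_real t) \<cdot>\<^sub>m (transpose_mat X * ?S * X)"
    by (simp add: ss smult_smult_mat)
  from concurrence_via_scale[OF X Y this]
  have "concurrence \<rho>' = concurrence \<rho> * (cmod (det A) * cmod (det B) / t)"
    using t concurrence_mult_adjoint[OF X] by (simp add: \<rho>' \<rho> norm_divide norm_mult)
  then show ?thesis unfolding tr' by simp
qed

end
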